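(* Assume $\mathsf{ZFC}$. Then the following are equivalent: (1) there exists a countably based partial $\mathsf{NCC}$-realiser $\zeta_{\mathsf p}$; (2) the Continuum Hypothesis $\mathsf{CH}$.
   Context: $2^{\mathbb N}$ denotes Cantor space (binary sequences). A partial $\mathsf{NCC}$-realiser is a partial functional $\zeta_{\mathsf p}$ whose arguments are total functions $Y:\mathbb N\times\mathbb N\times 2^{\mathbb N}\to\mathbb N$ such that: if $(\forall n\in\mathbb N)(\exists m\in\mathbb N)(\exists f\in 2^{\mathbb N})(Y(n,m,f)=0)$, then $\zeta_{\mathsf p}(Y)$ is defined and is a function $g:\mathbb N\to\mathbb N$ with $(\forall n)(\exists f\in 2^{\mathbb N})(Y(n,g(n),f)=0)$. (Nothing is required of $\zeta_{\mathsf p}(Y)$ for other $Y$.) Such a (partial, type-3-like) functional $\Phi$ is called countably based if for every argument $F$ at which $\Phi$ is defined there is a countable set $X$ of arguments of $F$ such that $\Phi(G)=\Phi(F)$ (in particular $\Phi(G)$ is defined) for every $G$ that agrees with $F$ on $X$. *)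

theory Defs
  imports "HOL-Analysis.Analysis"
begin

type_synonym cantor = "nat \<Rightarrow> bool"

(* Partial functionals are option-valued; None means "undefined". No condition is imposed
   on the value, or on definedness, at Y that do not satisfy the premise. *)
definition partial_NCC_realiser ::
    "((nat \<times> nat \<times> cantor \<Rightarrow> nat) \<Rightarrow> (nat \<Rightarrow> nat) option) \<Rightarrow> bool" where
  "partial_NCC_realiser \<zeta> \<longleftrightarrow>
     (\<forall>Y. (\<forall>n. \<exists>m. \<exists>f. Y (n, m, f) = 0) \<longrightarrow>
          (\<exists>g. \<zeta> Y = Some g \<and> (\<forall>n. \<exists>f. Y (n, g n, f) = 0)))"

(* The equation between option values also says that \<Phi> is defined at G. *)
definition countably_based :: "(('a \<Rightarrow> 'b) \<Rightarrow> 'c option) \<Rightarrow> bool" where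
  "countably_based \<Phi> \<longleftrightarrow>
     (\<forall>F. \<Phi> F \<noteq> None \<longrightarrow>
          (\<exists>X. countable X \<and> (\<forall>G. (\<forall>x\<in>X. G x = F x) \<longrightarrow> \<Phi> G = \<Phi> F)))"

(* No cardinality lies strictly between those of the naturals and the reals; countable
   includes finite. *)
definition Continuum_Hypothesis :: bool where
  "Continuum_Hypothesis \<longleftrightarrow> (\<forall>A :: real set. countable A \<or> A \<approx> (UNIV :: real set))"

end

theory Submission
  imports Defs
begin

unbundle cardinal_syntax

text \<open>
  If a countably based realiser exists, let \<open>F x\<close> and \<open>F' y\<close> be the sets of sequences occurring
  in countable bases at the arguments whose only zeros are at the \<open>(n, 0, x)\<close>, respectively at the
  \<open>(n, 1, y)\<close>. If \<open>y \<notin> F x\<close> and \<open>x \<notin> F' y\<close>, then the realiser would have to choose both \<open>0\<close> and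
  \<open>1\<close> at the argument with both kinds of zeros. So \<open>y \<in> F x\<close> or \<open>x \<in> F' y\<close> for all \<open>x\<close> and \<open>y\<close>,
  and by an argument of Sierpinski and Freiling every uncountable set has the size of the continuum.
  Conversely, under \<open>CH\<close> well-order Cantor space with countable initial segments. When the premise
  holds, countably many witnesses suffice, and hence some initial segment contains
  enough of them; the least such segment is a countable base for choosing the least \<open>m\<close> that is
  witnessed in it.
\<close>

lemma cantor_eqpoll_reals: "(UNIV :: cantor set) \<approx> (UNIV :: real set)"
proof -
  have "bij (Collect :: cantor \<Rightarrow> nat set)"
    by (rule bij_betw_byWitness[where f' = "\<lambda>S x. x \<in> S"]) auto
  then have "(UNIV :: cantor set) \<approx> (UNIV :: nat set set)"
    unfolding eqpoll_def by blast
  then show ?thesis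
    using nat_sets_eqpoll_reals by (rule eqpoll_trans)
qed

lemma uncountable_UNIV_cantor: "uncountable (UNIV :: cantor set)"
  using cantor_eqpoll_reals countable_eqpoll eqpoll_sym uncountable_UNIV_real by blast

lemma continuum_dichotomy_transfer:
  assumes AB: "(UNIV :: 'a set) \<approx> (UNIV :: 'b set)"
    and dich: "\<And>A :: 'a set. countable A \<or> A \<approx> (UNIV :: 'a set)"
  shows "countable (B :: 'b set) \<or> B \<approx> (UNIV :: 'b set)"
proof -
  obtain h :: "'b \<Rightarrow> 'a" where h: "bij h"
    using eqpoll_sym[OF AB] unfolding eqpoll_def by blast
  have B: "h ` B \<approx> B"
    using h by (intro inj_on_image_eqpoll_self) (meson bij_is_inj inj_on_subset subset_UNIV)
  from dich[of "h ` B"] show ?thesis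
    by (meson AB B countable_eqpoll eqpoll_sym eqpoll_trans)
qed

text \<open>Moves \<open>CH\<close> to the space where both the countable covers and the well-order
  live.\<close>

lemma Continuum_Hypothesis_iff_cantor:
  "Continuum_Hypothesis \<longleftrightarrow> (\<forall>A :: cantor set. countable A \<or> A \<approx> (UNIV :: cantor set))"
  unfolding Continuum_Hypothesis_def
  using continuum_dichotomy_transfer[OF cantor_eqpoll_reals]
    continuum_dichotomy_transfer[OF eqpoll_sym[OF cantor_eqpoll_reals]] by meson

lemma countable_UNION_lepoll:
  fixes A :: "'a set" and F :: "'a \<Rightarrow> 'b set"
  assumes "infinite A" and "\<And>x. x \<in> A \<Longrightarrow> countable (F x)"
  shows "(\<Union>x\<in>A. F x) \<lesssim> A"
proof -
  have F_le: "|F x| \<le>o |A|" if "x \<in> A" for x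
  proof -
    have "F x \<lesssim> (UNIV :: nat set)"
      using assms(2)[OF that] unfolding countable_def lepoll_def by blast
    also have "\<dots> \<lesssim> A"
      using assms(1) by (simp add: infinite_le_lepoll)
    finally show ?thesis
      by (simp add: lepoll_def card_of_ordLeq)
  qed
  have "|\<Union>x\<in>A. F x| \<le>o |A|"
    using assms(1) F_le by (intro card_of_UNION_ordLeq_infinite card_of_mono1) auto
  then show ?thesis
    by (simp add: lepoll_def card_of_ordLeq)
qed

text \<open>A point \<open>y\<close> outside every \<open>F x\<close> with \<open>x\<close> in
  \<open>A\<close> would force all of \<open>A\<close> into the countable set \<open>F' y\<close>.
  So \<open>A\<close>-many countable sets already cover the type.\<close>

lemma eqpoll_UNIV_if_countable_covers:
  fixes F F' :: "'a \<Rightarrow> 'a set" and A :: "'a set"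
  assumes F: "\<And>x. countable (F x)" and F': "\<And>y. countable (F' y)"
    and cover: "\<And>x y. y \<in> F x \<or> x \<in> F' y"
    and A: "uncountable A"
  shows "A \<approx> (UNIV :: 'a set)"
proof -
  have "y \<in> (\<Union>x\<in>A. F x)" for y
  proof (rule ccontr)
    assume "y \<notin> (\<Union>x\<in>A. F x)"
    then have "A \<subseteq> F' y"
      using cover by blast
    then show False
      using A F' countable_subset by blast
  qed
  then have "(\<Union>x\<in>A. F x) = UNIV"
    by blast
  moreover have "(\<Union>x\<in>A. F x) \<lesssim> A"
    using A F by (intro countable_UNION_lepoll) (auto intro: countable_finite)
  ultimately show ?thesis
    by (intro lepoll_antisym) (auto intro: subset_imp_lepoll)
qed

text \<open>Independent of \<open>n\<close>, so one pair \<open>m\<close>, \<open>f\<close>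
  satisfying \<open>P\<close> yields the realiser's premise for all \<open>n\<close> at
  once.\<close>

definition zero_at :: "(nat \<Rightarrow> cantor \<Rightarrow> bool) \<Rightarrow> nat \<times> nat \<times> cantor \<Rightarrow> nat" where
  "zero_at P = (\<lambda>(n, m, f). if P m f then 0 else 1)"

lemma zero_at_simp [simp]: "zero_at P (n, m, f) = 0 \<longleftrightarrow> P m f"
  by (simp add: zero_at_def)

text \<open>\<open>Q\<close> is constrained only on \<open>S\<close>. If \<open>x\<close> lies
  outside \<open>S\<close>, this just says that \<open>Q\<close> is false there.\<close>

definition decides_on ::
    "((nat \<times> nat \<times> cantor \<Rightarrow> nat) \<Rightarrow> (nat \<Rightarrow> nat) option) \<Rightarrow> nat \<Rightarrow> cantor \<Rightarrow> cantor set \<Rightarrow> bool" where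
  "decides_on \<zeta> i x S \<longleftrightarrow>
     (\<forall>Q. (\<forall>m. \<forall>f\<in>S. Q m f \<longleftrightarrow> m = i \<and> f = x) \<longrightarrow>
          (\<exists>g. \<zeta> (zero_at Q) = Some g \<and> g 0 = i))"

lemma decides_onD:
  assumes "decides_on \<zeta> i x S" and "\<And>m f. f \<in> S \<Longrightarrow> Q m f \<longleftrightarrow> m = i \<and> f = x"
  shows "\<exists>g. \<zeta> (zero_at Q) = Some g \<and> g 0 = i"
  using assms unfolding decides_on_def by simp

text \<open>With zeros only at the \<open>(n, i, x)\<close>, the realiser is forced to choose
  \<open>i\<close>. Projecting a countable base to its sequences keeps it countable, and agreement
  over the projection implies agreement on the base.\<close>

lemma realiser_singleton_base:
  assumes real: "partial_NCC_realiser \<zeta>" and base: "countably_based \<zeta>"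
  shows "\<exists>S. countable S \<and> decides_on \<zeta> i x S"
proof -
  let ?Y = "zero_at (\<lambda>m f. m = i \<and> f = x)"
  have "\<forall>n. \<exists>m f. ?Y (n, m, f) = 0"
    by simp
  then obtain g where g: "\<zeta> ?Y = Some g" and "\<forall>n. \<exists>f. ?Y (n, g n, f) = 0"
    using real unfolding partial_NCC_realiser_def by blast
  then have i: "g 0 = i"
    by simp
  obtain X where X: "countable X" "\<And>G. (\<forall>p\<in>X. G p = ?Y p) \<Longrightarrow> \<zeta> G = \<zeta> ?Y"
    using base[unfolded countably_based_def, rule_format, of ?Y] g by auto
  define S where "S = (\<lambda>(n, m, f). f) ` X"
  have "\<zeta> (zero_at Q) = Some g" if Q: "\<And>m f. f \<in> S \<Longrightarrow> Q m f \<longleftrightarrow> m = i \<and> f = x" for Q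
  proof -
    have "zero_at Q p = ?Y p" if "p \<in> X" for p
    proof -
      obtain n m f where p: "p = (n, m, f)"
        by (cases p)
      with that have "f \<in> S"
        unfolding S_def by force
      with Q p show ?thesis
        by (simp add: zero_at_def)
    qed
    then show ?thesis
      using X(2) g by simp
  qed
  with i have "decides_on \<zeta> i x S"
    by (simp add: decides_on_def)
  moreover have "countable S"
    using X(1) by (simp add: S_def)
  ultimately show ?thesis
    by blast
qed

lemma realiser_imp_CH:
  assumes real: "partial_NCC_realiser \<zeta>" and base: "countably_based \<zeta>"
  shows "Continuum_Hypothesis"
proof -
  obtain F where F: "\<And>i x. countable (F i x)" and dec: "\<And>i x. decides_on \<zeta> i x (F i x)"
    using realiser_singleton_base[OF real base] by metis
  have cover: "y \<in> F 0 x \<or> x \<in> F 1 y" for x y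
  proof (rule ccontr)
    assume "\<not> (y \<in> F 0 x \<or> x \<in> F 1 y)"
    then have y: "y \<notin> F 0 x" and x: "x \<notin> F 1 y"
      by auto
    \<comment> \<open>As \<open>F 0 x\<close> misses \<open>y\<close>, there \<open>?Q\<close> looks
      like the condition for \<open>0\<close> and \<open>x\<close> alone; as \<open>F 1 y\<close>
      misses \<open>x\<close>, there it looks like the one for \<open>1\<close> and
      \<open>y\<close>.\<close>
    let ?Q = "\<lambda>m f. m = 0 \<and> f = x \<or> m = 1 \<and> f = y"
    have "\<exists>g. \<zeta> (zero_at ?Q) = Some g \<and> g 0 = 0"
      by (rule decides_onD[OF dec[of 0 x]]) (use y in auto)
    moreover have "\<exists>g. \<zeta> (zero_at ?Q) = Some g \<and> g 0 = 1"
      by (rule decides_onD[OF dec[of 1 y]]) (use x in auto)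
    ultimately show False
      by auto
  qed
  show ?thesis
    unfolding Continuum_Hypothesis_iff_cantor
    using eqpoll_UNIV_if_countable_covers[of "F 0" "F 1", OF F F cover] by blast
qed

lemma CH_imp_countable_segments:
  assumes "Continuum_Hypothesis"
  shows "\<exists>r :: cantor rel. Well_order r \<and> Field r = UNIV \<and> (\<forall>a. countable (under r a))"
proof -
  \<comment> \<open>In a cardinal well-order every strict initial segment is smaller than the whole
    field, so \<open>CH\<close> leaves it only the option of being countable.\<close>
  let ?r = "|UNIV :: cantor set|"
  have "countable (under ?r a)" for a
  proof -
    have less: "|underS ?r a| <o ?r"
      by (rule card_of_underS[OF card_of_Card_order]) (simp add: Field_card_of)
    have "\<not> underS ?r a \<approx> (UNIV :: cantor set)"
      using less not_ordLess_ordIso unfolding eqpoll_iff_card_of_ordIso by blast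
    then have "countable (insert a (underS ?r a))"
      using assms unfolding Continuum_Hypothesis_iff_cantor by (metis countable_insert)
    moreover have "under ?r a \<subseteq> insert a (underS ?r a)"
      by (auto simp: under_def underS_def)
    ultimately show ?thesis
      by (rule countable_subset[rotated])
  qed
  then show ?thesis
    by (intro exI[of _ ?r] conjI allI card_of_Well_order Field_card_of)
qed

text \<open>If \<open>C\<close> were unbounded, totality would put every point below a member of
  \<open>C\<close>, making the type a countable union of countable segments.\<close>

lemma countable_subset_under:
  assumes r: "Well_order r" "Field r = (UNIV :: 'a set)"
    and seg: "\<And>a. countable (under r a)" and unc: "uncountable (UNIV :: 'a set)"
    and C: "countable C"
  shows "\<exists>a. C \<subseteq> under r a"
proof (rule ccontr)
  assume *: "\<nexists>a. C \<subseteq> under r a"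
  have "a \<in> (\<Union>c\<in>C. under r c)" for a
  proof -
    obtain c where "c \<in> C" "(c, a) \<notin> r"
      using * unfolding under_def by blast
    moreover from this have "(a, c) \<in> r"
      using wo_rel.TOTALS[of r] r unfolding wo_rel_def by blast
    ultimately show ?thesis
      unfolding under_def by blast
  qed
  then have "UNIV = (\<Union>c\<in>C. under r c)"
    by blast
  moreover have "countable (\<Union>c\<in>C. under r c)"
    using C seg by blast
  ultimately show False
    using unc by simp
qed

lemma CH_imp_realiser:
  assumes "Continuum_Hypothesis"
  shows "\<exists>\<zeta>. partial_NCC_realiser \<zeta> \<and> countably_based \<zeta>"
proof -
  obtain r :: "cantor rel" where r: "Well_order r" "Field r = UNIV"
    and seg: "\<And>a. countable (under r a)"
    using CH_imp_countable_segments[OF assms] by blast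
  have wo: "wo_rel r"
    using r by (simp add: wo_rel_def)
  define E where "E Y = {a. \<forall>n. \<exists>m. \<exists>f\<in>under r a. Y (n, m, f) = (0::nat)}" for Y :: "nat \<times> nat \<times> cantor \<Rightarrow> nat"
  define a where "a Y = wo_rel.minim r (E Y)" for Y
  define g where "g Y n = (LEAST m. \<exists>f\<in>under r (a Y). Y (n, m, f) = (0::nat))" for Y n
  \<comment> \<open>\<open>None\<close> guards the case where \<open>a Y\<close> would be the
    minimum of an empty set.\<close>
  define \<zeta> where "\<zeta> Y = (if E Y = {} then None else Some (g Y))" for Y
  have a_in: "a Y \<in> E Y" if "E Y \<noteq> {}" for Y
    unfolding a_def using that r by (intro wo_rel.minim_in[OF wo]) auto
  have a_least: "(a Y, b) \<in> r" if "b \<in> E Y" for Y b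
    unfolding a_def using that r by (intro wo_rel.minim_least[OF wo]) auto
  have "partial_NCC_realiser \<zeta>"
    unfolding partial_NCC_realiser_def
  proof (intro allI impI)
    fix Y :: "nat \<times> nat \<times> cantor \<Rightarrow> nat"
    assume "\<forall>n. \<exists>m f. Y (n, m, f) = 0"
    then obtain m f where mf: "\<And>n. Y (n, m n, f n) = 0"
      by metis
    obtain b where "range f \<subseteq> under r b"
      using countable_subset_under[OF r seg uncountable_UNIV_cantor, of "range f"] by auto
    then have "b \<in> E Y"
      unfolding E_def using mf by blast
    then have E: "E Y \<noteq> {}"
      by blast
    have "\<exists>f\<in>under r (a Y). Y (n, g Y n, f) = 0" for n
      unfolding g_def by (rule LeastI_ex) (use a_in[OF E] in \<open>simp add: E_def\<close>)
    then show "\<exists>g. \<zeta> Y = Some g \<and> (\<forall>n. \<exists>f. Y (n, g n, f) = 0)"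
      using E by (auto simp: \<zeta>_def)
  qed
  moreover have "countably_based \<zeta>"
    unfolding countably_based_def
  proof (intro allI impI)
    fix Y
    assume "\<zeta> Y \<noteq> None"
    then have E: "E Y \<noteq> {}"
      by (auto simp: \<zeta>_def split: if_splits)
    let ?X = "(UNIV :: nat set) \<times> (UNIV :: nat set) \<times> under r (a Y)"
    have "\<zeta> G = \<zeta> Y" if G: "\<forall>p\<in>?X. G p = Y p" for G
    proof -
      \<comment> \<open>Membership of \<open>b\<close> in \<open>E\<close> inspects only sequences
        up to \<open>b\<close>, and up to \<open>a Y\<close> the two arguments agree.\<close>
      have E_iff: "b \<in> E G \<longleftrightarrow> b \<in> E Y" if "(b, a Y) \<in> r" for b
      proof -
        have "under r b \<subseteq> under r (a Y)"
          using that wo_rel.TRANS[OF wo] by (auto simp: under_def dest: transD)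
        then have "\<And>n m f. f \<in> under r b \<Longrightarrow> G (n, m, f) = Y (n, m, f)"
          using G by blast
        then show ?thesis
          by (simp add: E_def)
      qed
      have refl: "(a Y, a Y) \<in> r"
        using a_least[OF a_in[OF E]] .
      have aG: "a Y \<in> E G"
        using E_iff[OF refl] a_in[OF E] by simp
      \<comment> \<open>Otherwise \<open>b\<close> would precede \<open>a Y\<close>, hence lie in
        \<open>E Y\<close> by \<open>E_iff\<close>, against leastness of \<open>a Y\<close>.\<close>
      have "(a Y, b) \<in> r" if "b \<in> E G" for b
        using that E_iff a_least wo_rel.TOTALS[OF wo] r(2) by blast
      then have "a Y = a G"
        unfolding a_def[of G] using aG r(2) by (intro wo_rel.equals_minim[OF wo]) auto
      then have "g G n = g Y n" for n
        using G by (simp add: g_def)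
      then have "g G = g Y"
        by blast
      then show ?thesis
        using E aG by (auto simp: \<zeta>_def)
    qed
    moreover have "countable ?X"
      by (intro countable_SIGMA countableI_type seg)
    ultimately show "\<exists>X. countable X \<and> (\<forall>G. (\<forall>p\<in>X. G p = Y p) \<longrightarrow> \<zeta> G = \<zeta> Y)"
      by blast
  qed
  ultimately show ?thesis
    by blast
qed

theorem theorem4p19:
  shows "(\<exists>\<zeta>. partial_NCC_realiser \<zeta> \<and> countably_based \<zeta>) \<longleftrightarrow> Continuum_Hypothesis"
  using realiser_imp_CH CH_imp_realiser by blast

end
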